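(* Let the asymmetric Laplace distribution with fixed $\mu$ and parameters $(p,\lambda)$ be written as an exponential family with natural parameter $\eta(\lambda,p)=(-\lambda\alpha,\,-\lambda\alpha^{-1})^T$ and $A(\lambda,p)=-\ln\beta$, where $\alpha=\sqrt{\frac{p}{1-p}}$ and $\beta=\frac{\lambda\alpha}{\alpha^2+1}$. Then its conjugate prior probability density function, with hyperparameters $\nu$ and $\chi=(\chi_1,\chi_2)$, is given by $$f(p,\lambda;\nu,\chi)=G(\lambda\alpha;\nu',\chi_1)\,G(\lambda\alpha^{-1};\nu',\chi_2)\,B(p;\nu'),$$ where $\nu'=1+\nu/2$, $$G(\Lambda;a,b)=\frac{b^a}{\Gamma(a)}\Lambda^{a-1}\exp(-\Lambda b)$$ is the gamma distribution, $\Gamma(\cdot)$ is the gamma function, $$B(p;a)=\frac{1}{B(a,a)}p^{a-1}(1-p)^{a-1}$$ is the symmetric beta distribution, and $B(\cdot,\cdot)$ (two arguments) is the beta function.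
   Context: For $p\in(0,1)$, $\lambda\in(0,\infty)$, $\mu\in\mathbb{R}$, with $\alpha=\sqrt{\frac{p}{1-p}}$ and $\beta=\frac{\lambda\alpha}{\alpha^2+1}$, the asymmetric Laplace density is $$\psi(x;\mu,\lambda,p)=\begin{cases}\beta\exp(-\lambda\alpha(x-\mu)), & x\ge\mu,\\ \beta\exp(\lambda\alpha^{-1}(x-\mu)), & x<\mu.\end{cases}$$ For fixed $\mu$ it equals $h(x)\exp(\eta(\lambda,p)^T T(x)-A(\lambda,p))$ with $h(x)=1$ and $T(x)=(|x-\mu|\,\mathbb{I}[x\ge\mu],\,|x-\mu|\,\mathbb{I}[x<\mu])^T$, where $\mathbb{I}[\cdot]$ is the indicator function. The conjugate prior of an exponential family with natural parameter $\eta$ and function $A$ is the density of the form $C(\chi,\nu)\exp(\eta^T\chi-\nu A)$ with hyperparameters $\chi,\nu$ and a factor $C(\chi,\nu)$ depending only on them; here it is written directly as a function of $(p,\lambda)$.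
   Formalization: The displayed f need not have total mass 1 in (p,λ): for ν=0, χ=(c,c) it is cπ/8. So f is shown to have the conjugate form C(χ,ν)exp(η·χ−νA), for χ1,χ2,ν'>0, and, instead of being a normalized probability density, to have finite positive mass for ν>−1. *)

theory Defs
  imports "HOL-Analysis.Analysis"
begin

text \<open>Parameters of the asymmetric Laplace family (location fixed) are pairs \<open>(p, \<lambda>)\<close>.\<close>

definition AL_params :: "(real \<times> real) set" where
  "AL_params = {0<..<1} \<times> {0<..}"

definition AL_alpha :: "real \<Rightarrow> real" where
  "AL_alpha p = sqrt (p / (1 - p))"

definition AL_beta :: "real \<Rightarrow> real \<Rightarrow> real" where
  "AL_beta p l = l * AL_alpha p / ((AL_alpha p)\<^sup>2 + 1)"

definition AL_density :: "real \<Rightarrow> real \<times> real \<Rightarrow> real \<Rightarrow> real" where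
  "AL_density \<mu> = (\<lambda>(p, l) x.
     if x \<ge> \<mu> then AL_beta p l * exp (- l * AL_alpha p * (x - \<mu>))
     else AL_beta p l * exp (l * inverse (AL_alpha p) * (x - \<mu>)))"

definition AL_eta :: "real \<times> real \<Rightarrow> real \<times> real" where
  "AL_eta = (\<lambda>(p, l). (- l * AL_alpha p, - l * inverse (AL_alpha p)))"

definition AL_stat :: "real \<Rightarrow> real \<Rightarrow> real \<times> real" where
  "AL_stat \<mu> x = (\<bar>x - \<mu>\<bar> * indicator {\<mu>..} x, \<bar>x - \<mu>\<bar> * indicator {..<\<mu>} x)"

definition AL_A :: "real \<times> real \<Rightarrow> real" where
  "AL_A = (\<lambda>(p, l). - ln (AL_beta p l))"

definition exponential_family ::
  "'p set \<Rightarrow> ('p \<Rightarrow> 'x \<Rightarrow> real) \<Rightarrow> ('x \<Rightarrow> real) \<Rightarrow> ('p \<Rightarrow> 'v::real_inner)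
     \<Rightarrow> ('x \<Rightarrow> 'v) \<Rightarrow> ('p \<Rightarrow> real) \<Rightarrow> bool" where
  "exponential_family \<Theta> \<psi> h \<eta> T A \<longleftrightarrow>
     (\<forall>\<theta>\<in>\<Theta>. \<forall>x. \<psi> \<theta> x = h x * exp (\<eta> \<theta> \<bullet> T x - A \<theta>))"

text \<open>
  The factor \<open>C\<close> is chosen before the parameter \<open>\<theta>\<close>, so it depends on the hyperparameters
  \<open>chi\<close>, \<open>\<nu>\<close> only; \<open>H\<close> is the set of admissible hyperparameters. \<open>C\<close> need not normalise
  the total mass over \<open>\<Theta>\<close> to 1. The function \<open>AL_prior\<close> below is not normalised for
  Lebesgue measure in \<open>(p, \<lambda>)\<close>: for \<open>chi = (c, c)\<close> and \<open>\<nu> = 0\<close> its mass is \<open>c * pi / 8\<close>.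
\<close>

definition conjugate_prior ::
  "'p set \<Rightarrow> ('p \<Rightarrow> 'v::real_inner) \<Rightarrow> ('p \<Rightarrow> real) \<Rightarrow> ('v \<times> real) set
     \<Rightarrow> ('v \<Rightarrow> real \<Rightarrow> 'p \<Rightarrow> real) \<Rightarrow> bool" where
  "conjugate_prior \<Theta> \<eta> A H f \<longleftrightarrow>
     (\<exists>C. \<forall>chi \<nu>. (chi, \<nu>) \<in> H \<longrightarrow> C chi \<nu> > 0 \<and>
        (\<forall>\<theta>\<in>\<Theta>. f chi \<nu> \<theta> = C chi \<nu> * exp (\<eta> \<theta> \<bullet> chi - \<nu> * A \<theta>)))"

definition gamma_pdf :: "real \<Rightarrow> real \<Rightarrow> real \<Rightarrow> real" where
  "gamma_pdf x a b = b powr a / Gamma a * x powr (a - 1) * exp (- x * b)"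

definition sym_beta_pdf :: "real \<Rightarrow> real \<Rightarrow> real" where
  "sym_beta_pdf p a = 1 / Beta a a * p powr (a - 1) * (1 - p) powr (a - 1)"

definition AL_prior :: "real \<times> real \<Rightarrow> real \<Rightarrow> real \<times> real \<Rightarrow> real" where
  "AL_prior = (\<lambda>(chi1, chi2) \<nu> (p, l). let \<nu>' = 1 + \<nu> / 2 in
     gamma_pdf (l * AL_alpha p) \<nu>' chi1 * gamma_pdf (l * inverse (AL_alpha p)) \<nu>' chi2
       * sym_beta_pdf p \<nu>')"

text \<open>
  Exactly the hyperparameters for which the two gamma factors and the beta factor are
  genuine distributions (positive shapes and rates).
\<close>

definition AL_hyper :: "((real \<times> real) \<times> real) set" where
  "AL_hyper = {((chi1, chi2), \<nu>). chi1 > 0 \<and> chi2 > 0 \<and> 1 + \<nu> / 2 > 0}"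

end

theory Submission
  imports Defs
begin

text \<open>
  Since \<open>\<alpha>\<^sup>2 + 1 = 1 / (1 - p)\<close>, one has \<open>\<beta> = \<lambda> (p (1 - p))\<^bsup>1/2\<^esup>\<close>, while
  \<open>(\<lambda>\<alpha>) (\<lambda>\<alpha>\<^sup>-\<^sup>1) = \<lambda>\<^sup>2\<close>; hence \<open>\<beta>\<^sup>\<nu>\<close> splits into the power factors of the two gamma
  densities and of the beta density. For integrability, put \<open>t = \<alpha>\<chi>\<^sub>1 + \<alpha>\<^sup>-\<^sup>1\<chi>\<^sub>2\<close>. The
  \<open>\<lambda>\<close>-integral of \<open>\<beta>\<^sup>\<nu> exp (- \<lambda>t)\<close> is
  \<open>\<Gamma>(\<nu> + 1) (p (1 - p))\<^bsup>\<nu>/2\<^esup> t\<^bsup>-(\<nu>+1)\<^esup>\<close>, and \<open>t \<ge> min \<chi>\<^sub>1 \<chi>\<^sub>2 (p (1 - p))\<^bsup>-1/2\<^esup>\<close>, which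
  leaves a multiple of the beta integrand \<open>(p (1 - p))\<^bsup>\<nu>+1/2\<^esup>\<close>.
\<close>

section \<open>Integration tools\<close>

text \<open>Euler's integral for \<open>Gamma s\<close> under the substitution of
  \<open>t * x\<close> for the variable, rescaled by \<open>t powr (1 - s)\<close>.\<close>

lemma has_bochner_integral_Gamma_rate:
  fixes s t :: real
  assumes "s > 0" "t > 0"
  shows "has_bochner_integral lborel (\<lambda>x. indicator {0<..} x * (x powr (s - 1) * exp (- x * t)))
    (Gamma s / t powr s)"
proof -
  have "has_bochner_integral lborel
      (\<lambda>x. indicator {0..} x * x powr (s - 1) / exp x) (Gamma s)"
    using Gamma_conv_nn_integral_real[OF assms(1)] assms
    by (intro has_bochner_integral_nn_integral) (auto simp: Gamma_real_nonneg)
  then have "has_bochner_integral lborel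
      (\<lambda>x. indicator {0..} (0 + t * x) * (0 + t * x) powr (s - 1) / exp (0 + t * x))
      (Gamma s /\<^sub>R \<bar>t\<bar>)"
    using assms by (subst (asm) lborel_has_bochner_integral_real_affine_iff[where c = t and t = 0]) auto
  then have "has_bochner_integral lborel
      (\<lambda>x. t powr (1 - s) * (indicator {0..} (0 + t * x) * (0 + t * x) powr (s - 1) / exp (0 + t * x)))
      (t powr (1 - s) * (Gamma s /\<^sub>R \<bar>t\<bar>))"
    by (rule has_bochner_integral_mult_right)
  moreover have "t powr (1 - s) * (Gamma s /\<^sub>R \<bar>t\<bar>) = Gamma s / t powr s"
    using assms by (simp add: powr_diff field_simps)
  \<comment> \<open>The indicators differ at 0, but there \<open>0 powr (s - 1) = 0\<close>, so the
    functions agree pointwise.\<close>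
  moreover have "t powr (1 - s) *
        (indicator {0..} (0 + t * x) * (0 + t * x) powr (s - 1) / exp (0 + t * x))
      = indicator {0<..} x * (x powr (s - 1) * exp (- x * t))" for x
    using assms
    by (auto simp: indicator_def powr_mult powr_diff exp_minus field_simps zero_le_mult_iff)
  ultimately show ?thesis
    by simp
qed

text \<open>A nonnegative function with integral zero vanishes almost everywhere; as
  \<open>f\<close> is positive on \<open>A\<close>, this would make \<open>A\<close> a null
  set.\<close>

lemma set_integral_pos:
  fixes f :: "'a \<Rightarrow> real"
  assumes int: "set_integrable M A f" and A: "A \<in> sets M" "emeasure M A \<noteq> 0"
    and pos: "\<And>x. x \<in> A \<Longrightarrow> f x > 0"
  shows "(LINT x:A|M. f x) > 0"
proof (rule ccontr)
  let ?g = "\<lambda>x. indicator A x *\<^sub>R f x"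
  have nonneg: "0 \<le> ?g x" for x
    using pos by (auto simp: indicator_def less_imp_le)
  have ge0: "0 \<le> integral\<^sup>L M ?g"
    using nonneg by (intro integral_nonneg_AE) auto
  assume "\<not> (LINT x:A|M. f x) > 0"
  with ge0 have "integral\<^sup>L M ?g = 0"
    unfolding set_lebesgue_integral_def by linarith
  with int nonneg have "AE x in M. ?g x = 0"
    unfolding set_integrable_def by (subst (asm) integral_nonneg_eq_0_iff_AE) auto
  then have "AE x in M. x \<notin> A"
    by eventually_elim (use pos in \<open>force simp: indicator_def\<close>)
  then have "A \<in> null_sets M"
    using A by (simp add: AE_iff_null_sets)
  with A show False
    by auto
qed

section \<open>Algebra of \<alpha>, \<beta> and the prior\<close>

lemma AL_alpha_pos: "0 < p \<Longrightarrow> p < 1 \<Longrightarrow> AL_alpha p > 0"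
  by (simp add: AL_alpha_def)

lemma AL_beta_eq:
  assumes "0 < p" "p < 1"
  shows "AL_beta p l = l * sqrt (p * (1 - p))"
proof -
  have "(AL_alpha p)\<^sup>2 + 1 = 1 / (1 - p)"
    using assms by (simp add: AL_alpha_def field_simps)
  moreover have "AL_alpha p * (1 - p) = sqrt (p * (1 - p))"
  proof -
    have "AL_alpha p * (1 - p) = sqrt p / sqrt (1 - p) * (sqrt (1 - p) * sqrt (1 - p))"
      using assms by (simp add: AL_alpha_def real_sqrt_divide)
    also have "\<dots> = sqrt (p * (1 - p))"
      using assms by (simp add: real_sqrt_mult del: real_sqrt_mult_self)
    finally show ?thesis .
  qed
  ultimately show ?thesis
    by (simp add: AL_beta_def)
qed

lemma AL_beta_powr:
  assumes "0 < p" "p < 1" "0 < l"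
  shows "AL_beta p l powr \<nu> = l powr \<nu> * (p * (1 - p)) powr (\<nu> / 2)"
  using assms by (simp add: AL_beta_eq powr_mult powr_half_sqrt[symmetric] powr_powr)

text \<open>Separates a constant in the hyperparameters from the kernel in (p, \<lambda>); conjugacy
  and integrability both start from this form.\<close>

lemma AL_prior_eq:
  fixes p l c1 c2 \<nu> :: real
  assumes "0 < p" "p < 1" "0 < l"
  defines "a \<equiv> 1 + \<nu> / 2"
  shows "AL_prior (c1, c2) \<nu> (p, l)
    = c1 powr a / Gamma a * (c2 powr a / Gamma a) * (1 / Beta a a)
      * (l powr \<nu> * (p * (1 - p)) powr (\<nu> / 2)
        * exp (- l * (AL_alpha p * c1 + inverse (AL_alpha p) * c2)))"
proof -
  have pos: "AL_alpha p > 0"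
    using assms AL_alpha_pos by simp
  \<comment> \<open>The shapes minus 1 both equal \<open>\<nu> / 2\<close>, so \<alpha> cancels
    between the gamma factors.\<close>
  have "(l * AL_alpha p) powr (\<nu> / 2) * (l * inverse (AL_alpha p)) powr (\<nu> / 2)
      = (l * l) powr (\<nu> / 2)"
    using assms pos by (simp add: powr_mult[symmetric] field_simps)
  also have "\<dots> = l powr \<nu>"
    using assms by (simp add: powr_mult powr_add[symmetric])
  finally have l: "l powr \<nu>
      = (l * AL_alpha p) powr (\<nu> / 2) * (l * inverse (AL_alpha p)) powr (\<nu> / 2)" ..
  have e: "exp (- l * (AL_alpha p * c1 + inverse (AL_alpha p) * c2))
      = exp (- (l * AL_alpha p) * c1) * exp (- (l * inverse (AL_alpha p)) * c2)"
    by (simp add: exp_add[symmetric] algebra_simps)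
  have w: "(p * (1 - p)) powr (\<nu> / 2) = p powr (\<nu> / 2) * (1 - p) powr (\<nu> / 2)"
    using assms by (simp add: powr_mult)
  have a: "a - 1 = \<nu> / 2"
    by (simp add: a_def)
  show ?thesis
    unfolding AL_prior_def gamma_pdf_def sym_beta_pdf_def prod.case Let_def a_def[symmetric]
      a l e w
    by (simp only: mult_ac)
qed

lemma AL_prior_const_pos:
  fixes a c1 c2 :: real
  assumes "a > 0" "c1 > 0" "c2 > 0"
  shows "c1 powr a / Gamma a * (c2 powr a / Gamma a) * (1 / Beta a a) > 0"
  using assms by (simp add: Beta_def Gamma_real_pos)

section \<open>Exponential family and conjugacy\<close>

lemma AL_exponential_family:
  "exponential_family AL_params (AL_density \<mu>) (\<lambda>x. 1) AL_eta (AL_stat \<mu>) AL_A"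
proof -
  have "AL_density \<mu> (p, l) x = exp (AL_eta (p, l) \<bullet> AL_stat \<mu> x - AL_A (p, l))"
    if "0 < p" "p < 1" "0 < l" for p l x
  proof -
    have "AL_beta p l > 0"
      using that by (simp add: AL_beta_eq)
    then show ?thesis
      by (auto simp: AL_density_def AL_eta_def AL_stat_def AL_A_def exp_add exp_diff
          indicator_def algebra_simps)
  qed
  then show ?thesis
    by (auto simp: exponential_family_def AL_params_def)
qed

lemma AL_conjugate_prior: "conjugate_prior AL_params AL_eta AL_A AL_hyper AL_prior"
proof -
  define C :: "real \<times> real \<Rightarrow> real \<Rightarrow> real" where "C = (\<lambda>(c1, c2) \<nu>. let a = 1 + \<nu> / 2 in
    c1 powr a / Gamma a * (c2 powr a / Gamma a) * (1 / Beta a a))"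
  have pos: "C (c1, c2) \<nu> > 0" if "((c1, c2), \<nu>) \<in> AL_hyper" for c1 c2 \<nu>
    using that AL_prior_const_pos[of "1 + \<nu> / 2" c1 c2]
    by (simp add: C_def AL_hyper_def Let_def)
  have "AL_prior (c1, c2) \<nu> (p, l)
      = C (c1, c2) \<nu> * exp (AL_eta (p, l) \<bullet> (c1, c2) - \<nu> * AL_A (p, l))"
    if "0 < p" "p < 1" "0 < l" for c1 c2 \<nu> p l
  proof -
    have "AL_beta p l > 0"
      using that by (simp add: AL_beta_eq)
    \<comment> \<open>Since A = - ln \<beta> with \<beta> > 0, the term - \<nu> A contributes the
      factor \<beta> to the power \<nu>.\<close>
    then have "exp (AL_eta (p, l) \<bullet> (c1, c2) - \<nu> * AL_A (p, l))
        = AL_beta p l powr \<nu> * exp (- l * (AL_alpha p * c1 + inverse (AL_alpha p) * c2))"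
      by (simp add: AL_eta_def AL_A_def powr_def exp_add[symmetric] algebra_simps)
    with that show ?thesis
      by (simp only: AL_prior_eq AL_beta_powr C_def Let_def prod.case)
  qed
  with pos show ?thesis
    unfolding conjugate_prior_def
    by (intro exI[of _ C]) (auto simp: AL_params_def)
qed

section \<open>Finite positive mass\<close>

text \<open>Lowering both hyperparameters to \<open>m\<close> leaves m times \<alpha> + 1/\<alpha>,
  and this sum is (p + (1 - p)) / sqrt(p (1 - p)) with numerator 1.\<close>

lemma AL_rate_ge:
  assumes "0 < p" "p < 1" "0 < m" "m \<le> c1" "m \<le> c2"
  shows "AL_alpha p * c1 + inverse (AL_alpha p) * c2 \<ge> m * (p * (1 - p)) powr (- 1 / 2)"
proof -
  have w: "(p * (1 - p)) powr (- 1 / 2) = AL_alpha p + inverse (AL_alpha p)"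
  proof -
    have "(p * (1 - p)) powr (- 1 / 2) = 1 / (sqrt p * sqrt (1 - p))"
      using assms by (simp add: powr_minus_divide powr_half_sqrt real_sqrt_mult)
    also have "\<dots> = ((sqrt p)\<^sup>2 + (sqrt (1 - p))\<^sup>2) / (sqrt p * sqrt (1 - p))"
      using assms by simp
    also have "\<dots> = AL_alpha p + inverse (AL_alpha p)"
      using assms
      by (simp add: AL_alpha_def real_sqrt_divide add_divide_distrib power2_eq_square
          del: real_sqrt_mult_self real_sqrt_pow2)
    finally show ?thesis .
  qed
  have "AL_alpha p > 0"
    using assms AL_alpha_pos by simp
  then have "m * (AL_alpha p + inverse (AL_alpha p))
      \<le> AL_alpha p * c1 + inverse (AL_alpha p) * c2"
    using assms by (simp add: distrib_left mult.commute add_mono mult_right_mono)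
  with w show ?thesis
    by simp
qed

lemma AL_params_sets: "AL_params \<in> sets lborel"
  by (simp add: AL_params_def borel_Times)

lemma emeasure_AL_params: "emeasure lborel AL_params \<noteq> 0"
proof -
  have "{0<..<1} \<times> {0<..<1} \<subseteq> AL_params"
    by (auto simp: AL_params_def)
  then have "emeasure lborel ({0<..<1} \<times> {0<..<1} :: (real \<times> real) set) \<le> emeasure lborel AL_params"
    by (intro emeasure_mono AL_params_sets)
  moreover have "emeasure lborel ({0<..<1} \<times> {0<..<1} :: (real \<times> real) set) = 1"
    by (simp add: lborel_prod[symmetric] lborel.emeasure_pair_measure_Times)
  ultimately show ?thesis
    by auto
qed

text \<open>Fubini-Tonelli, integrating over \<lambda> first. The condition \<nu> > -1 makes the
  power of \<lambda> integrable near 0.\<close>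

lemma AL_kernel_integrable:
  assumes "c1 > 0" "c2 > 0" "\<nu> > -1"
  shows "set_integrable lborel AL_params (\<lambda>(p, l). l powr \<nu> * (p * (1 - p)) powr (\<nu> / 2)
      * exp (- l * (AL_alpha p * c1 + inverse (AL_alpha p) * c2)))"
proof -
  define m where "m = min c1 c2"
  define w where "w p = p * (1 - p)" for p :: real
  define t where "t p = AL_alpha p * c1 + inverse (AL_alpha p) * c2" for p
  \<comment> \<open>\<open>g\<close> is the kernel extended by zero to the plane, its \<lambda>-part
    shaped as a gamma integrand of shape \<open>\<nu> + 1\<close>; \<open>G\<close> is its
    \<lambda>-integral.\<close>
  define g where "g = (\<lambda>(p, l). indicator {0<..<1} p * w p powr (\<nu> / 2)
    * (indicator {0<..} l * (l powr ((\<nu> + 1) - 1) * exp (- l * t p))))"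
  define G where "G p = indicator {0<..<1} p * w p powr (\<nu> / 2)
    * (Gamma (\<nu> + 1) / t p powr (\<nu> + 1))" for p
  have [measurable]: "w \<in> borel_measurable borel" "t \<in> borel_measurable borel"
    unfolding w_def t_def AL_alpha_def by measurable
  have m: "m > 0" "m \<le> c1" "m \<le> c2"
    using assms by (auto simp: m_def)
  have t_pos: "t p > 0" if "p \<in> {0<..<1}" for p
    using that assms AL_alpha_pos[of p] by (simp add: t_def add_pos_pos)
  have inner: "has_bochner_integral lborel (\<lambda>l. g (p, l)) (G p)" for p
  proof (cases "p \<in> {0<..<1}")
    case True
    have "has_bochner_integral lborel (\<lambda>l. indicator {0<..<1} p * w p powr (\<nu> / 2)
        * (indicator {0<..} l * (l powr ((\<nu> + 1) - 1) * exp (- l * t p))))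
      (indicator {0<..<1} p * w p powr (\<nu> / 2) * (Gamma (\<nu> + 1) / t p powr (\<nu> + 1)))"
      using has_bochner_integral_Gamma_rate[of "\<nu> + 1" "t p"] assms t_pos[OF True]
      by (intro has_bochner_integral_mult_right) auto
    then show ?thesis
      by (simp add: g_def G_def)
  next
    case False
    then show ?thesis
      by (simp add: g_def G_def has_bochner_integral_zero)
  qed
  have g_nonneg: "g x \<ge> 0" for x
    by (auto simp: g_def split: prod.split)
  have G_bound: "norm (G p) \<le> norm (Gamma (\<nu> + 1) / m powr (\<nu> + 1) *
      (indicator {0..1} p * (p powr (\<nu> + 3 / 2 - 1) * (1 - p) powr (\<nu> + 3 / 2 - 1))))" for p
  proof (cases "p \<in> {0<..<1}")
    case True
    then have w_pos: "w p > 0"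
      by (simp add: w_def)
    have Gam: "Gamma (\<nu> + 1) > 0"
      using assms by (simp add: Gamma_real_pos)
    \<comment> \<open>As \<open>\<nu> + 1 > 0\<close>, the lower bound on \<open>t p\<close>
      survives the power; in the denominator of \<open>G p\<close> it becomes an upper
      bound.\<close>
    have "m powr (\<nu> + 1) * w p powr (- ((\<nu> + 1) / 2)) = (m * w p powr (- 1 / 2)) powr (\<nu> + 1)"
      using m w_pos by (simp add: powr_mult powr_powr)
    also have "\<dots> \<le> t p powr (\<nu> + 1)"
      using AL_rate_ge[of p m c1 c2] True m assms w_pos
      by (intro powr_mono2) (auto simp: t_def w_def)
    finally have "G p \<le> w p powr (\<nu> / 2)
        * (Gamma (\<nu> + 1) / (m powr (\<nu> + 1) * w p powr (- ((\<nu> + 1) / 2))))"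
      using True m w_pos Gam t_pos[OF True]
      by (auto simp: G_def intro!: mult_left_mono divide_left_mono mult_pos_pos)
    also have "\<dots> = Gamma (\<nu> + 1) / m powr (\<nu> + 1)
        * (w p powr (\<nu> / 2) / w p powr (- ((\<nu> + 1) / 2)))"
      by simp
    \<comment> \<open>The exponent \<nu> + 1/2 is written as \<open>a - 1\<close> with
      \<open>a = \<nu> + 3 / 2 > 0\<close>, the form of the beta integrand.\<close>
    also have "w p powr (\<nu> / 2) / w p powr (- ((\<nu> + 1) / 2)) = w p powr (\<nu> + 3 / 2 - 1)"
      by (subst powr_diff[symmetric]) (simp add: field_simps)
    also have "\<dots> = p powr (\<nu> + 3 / 2 - 1) * (1 - p) powr (\<nu> + 3 / 2 - 1)"
      using True by (simp add: w_def powr_mult)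
    finally show ?thesis
      using True Gam by (simp add: G_def)
  qed (simp add: G_def)
  have "set_integrable lborel {0..1}
      (\<lambda>p::real. p powr (\<nu> + 3 / 2 - 1) * (1 - p) powr (\<nu> + 3 / 2 - 1))"
    using assms by (intro integrable_Beta) auto
  then have "integrable lborel (\<lambda>p. Gamma (\<nu> + 1) / m powr (\<nu> + 1) *
      (indicator {0..1} p * (p powr (\<nu> + 3 / 2 - 1) * (1 - p) powr (\<nu> + 3 / 2 - 1))))"
    by (intro integrable_mult_right) (simp add: set_integrable_def)
  then have "integrable lborel G"
    by (rule Bochner_Integration.integrable_bound) (use G_bound in \<open>auto simp: G_def[abs_def]\<close>)
  \<comment> \<open>Because \<open>g\<close> is nonnegative, integrability of \<open>G\<close> is
    already the absolute condition of Fubini's theorem.\<close>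
  moreover have "(\<integral>l. norm (g (p, l)) \<partial>lborel) = G p" for p
    using inner[of p] g_nonneg by (simp add: has_bochner_integral_integral_eq)
  ultimately have "integrable (lborel \<Otimes>\<^sub>M lborel) g"
    using inner
    by (intro lborel_pair.Fubini_integrable)
      (auto simp: g_def has_bochner_integral_iff)
  moreover have "indicator AL_params x *\<^sub>R (case x of (p, l) \<Rightarrow>
      l powr \<nu> * (p * (1 - p)) powr (\<nu> / 2)
        * exp (- l * (AL_alpha p * c1 + inverse (AL_alpha p) * c2))) = g x" for x
    by (auto simp: g_def AL_params_def w_def t_def indicator_def split: prod.split)
  ultimately show ?thesis
    by (simp add: set_integrable_def lborel_prod)
qed

text \<open>Dividing by this mass turns the prior into a probability density, a point that
  \<open>conjugate_prior\<close> leaves open.\<close>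

lemma AL_prior_mass:
  assumes "c1 > 0" "c2 > 0" "\<nu> > -1"
  shows "set_integrable lborel AL_params (AL_prior (c1, c2) \<nu>)"
    and "(LINT \<theta>:AL_params|lborel. AL_prior (c1, c2) \<nu> \<theta>) > 0"
proof -
  define a where "a = 1 + \<nu> / 2"
  define K where "K = c1 powr a / Gamma a * (c2 powr a / Gamma a) * (1 / Beta a a)"
  have K: "K > 0"
    using assms AL_prior_const_pos[of a c1 c2] by (simp add: K_def a_def)
  have eq: "AL_prior (c1, c2) \<nu> x = K * (case x of (p, l) \<Rightarrow>
      l powr \<nu> * (p * (1 - p)) powr (\<nu> / 2)
        * exp (- l * (AL_alpha p * c1 + inverse (AL_alpha p) * c2)))" if "x \<in> AL_params" for x
    using that by (cases x) (simp add: AL_params_def AL_prior_eq K_def a_def)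
  have "set_integrable lborel AL_params (\<lambda>x. K * (case x of (p, l) \<Rightarrow>
      l powr \<nu> * (p * (1 - p)) powr (\<nu> / 2)
        * exp (- l * (AL_alpha p * c1 + inverse (AL_alpha p) * c2))))"
    using AL_kernel_integrable[OF assms] by (rule set_integrable_mult_right)
  then show int: "set_integrable lborel AL_params (AL_prior (c1, c2) \<nu>)"
    by (subst set_integrable_cong[OF refl refl eq])
  have "AL_prior (c1, c2) \<nu> x > 0" if "x \<in> AL_params" for x
    using that K by (auto simp: eq[OF that] AL_params_def)
  then show "(LINT \<theta>:AL_params|lborel. AL_prior (c1, c2) \<nu> \<theta>) > 0"
    by (intro set_integral_pos int AL_params_sets emeasure_AL_params)
qed

theorem theorem9:
  fixes \<mu> :: real
  shows "exponential_family AL_params (AL_density \<mu>) (\<lambda>x. 1) AL_eta (AL_stat \<mu>) AL_A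
    \<and> conjugate_prior AL_params AL_eta AL_A AL_hyper AL_prior
    \<and> (\<forall>chi \<nu>. (chi, \<nu>) \<in> AL_hyper \<and> \<nu> > -1 \<longrightarrow>
         set_integrable lborel AL_params (AL_prior chi \<nu>)
         \<and> (LINT \<theta>:AL_params|lborel. AL_prior chi \<nu> \<theta>) > 0)"
  using AL_exponential_family AL_conjugate_prior AL_prior_mass
  by (auto simp: AL_hyper_def)

end
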